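(* As $n\to+\infty$ with $n\in\mathcal N_2$, $$\mathrm m(\alpha_n)=\mathrm m(C_2)\cdot n+\frac12\big(\mathrm m(C_2)-\log 2\big)+O\Big(\frac1n\Big).$$
   Context: $\mathcal N_2$ is the set of positive integers $n$ such that $n+1$ is not prime and $p:=2n+1$ is prime. For $n\in\mathcal N_2$, $\alpha_n:=\zeta_p+\zeta_p^{-1}=2\cos(2\pi/p)$, with $\zeta_p=e^{2\pi i/p}$. For an algebraic integer $\alpha$, $\mathrm m(\alpha):=\sum_{\alpha'}\max\{0,\log|\alpha'|\}$ over all conjugates $\alpha'$ of $\alpha$ over $\mathbf Q$. $C_2$ is the hypersurface $x_0+x_1+1/x_1=0$ in $\mathbf G_m^2$, and $\mathrm m(C_2):=\int_{\mathbf T^2}\log|x_0+x_1+1/x_1|\,d\mu$, with $\mathbf T$ the complex unit circle and $\mu$ normalized Haar measure. *)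

theory Defs
  imports
    "HOL-Analysis.Analysis"
    "HOL-Library.Landau_Symbols"
    "HOL-Computational_Algebra.Computational_Algebra"
begin

definition N2 :: "nat set" where
  "N2 = {n. n > 0 \<and> \<not> prime (n + 1) \<and> prime (2 * n + 1)}"

definition zeta :: "nat \<Rightarrow> complex" where
  "zeta p = exp (2 * of_real pi * \<i> / of_nat p)"

definition alpha :: "nat \<Rightarrow> complex" where
  "alpha n = zeta (2 * n + 1) + inverse (zeta (2 * n + 1))"

definition is_min_poly :: "rat poly \<Rightarrow> complex \<Rightarrow> bool" where
  "is_min_poly f a \<longleftrightarrow>
     lead_coeff f = 1 \<and> irreducible f \<and> poly (map_poly of_rat f) a = 0"

text \<open>An irreducible rational polynomial is separable, so the set of conjugates carries
  no multiplicities.\<close>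

definition conjugates :: "complex \<Rightarrow> complex set" where
  "conjugates a = {b. \<exists>f. is_min_poly f a \<and> poly (map_poly of_rat f) b = 0}"

text \<open>Since \<open>ln 0 = 0\<close>, a conjugate equal to \<open>0\<close> contributes \<open>0\<close>,
  as it does under the convention \<open>log 0 = -\<infinity>\<close>.\<close>

definition mahler :: "complex \<Rightarrow> real" where
  "mahler a = (\<Sum>b\<in>conjugates a. max 0 (ln (cmod b)))"

text \<open>Normalized Haar measure on the unit circle, as the image of Lebesgue measure on
  \<open>[0, 1]\<close> under \<open>t \<mapsto> e\<^sup>2\<^sup>\<pi>\<^sup>i\<^sup>t\<close>.\<close>

definition circle_haar :: "complex measure" where
  "circle_haar =
     distr (restrict_space lborel {0..1}) (restrict_space borel (sphere 0 1))
       (\<lambda>t. cis (2 * pi * t))"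

lemma emeasure_circle_haar_space: "emeasure circle_haar (space circle_haar) = 1"
proof -
  have "continuous_on UNIV (\<lambda>t::real. cis (2 * pi * t))"
    by (intro continuous_intros)
  then have "(\<lambda>t. cis (2 * pi * t)) \<in> borel_measurable borel"
    by (rule borel_measurable_continuous_onI)
  then have "(\<lambda>t. cis (2 * pi * t))
      \<in> restrict_space lborel {0..1} \<rightarrow>\<^sub>M restrict_space borel (sphere 0 1)"
    by (auto intro!: measurable_restrict_space2 measurable_restrict_space1)
  moreover have "space (restrict_space borel (sphere (0::complex) 1)) = sphere 0 1"
    by (simp add: space_restrict_space)
  moreover have "(\<lambda>t. cis (2 * pi * t)) -` sphere 0 1 = UNIV"
    by auto
  ultimately show ?thesis
    unfolding circle_haar_def
    by (subst emeasure_distr)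
       (simp_all add: space_restrict_space emeasure_restrict_space sets_restrict_space_iff)
qed

text \<open>On the curve \<open>x\<^sub>0 + x\<^sub>1 + 1/x\<^sub>1 = 0\<close> itself, a null set of the torus, the integrand
  takes the junk value \<open>0\<close>.\<close>

definition mC2 :: real where
  "mC2 = (\<integral>x. ln (cmod (fst x + snd x + 1 / snd x)) \<partial>(circle_haar \<Otimes>\<^sub>M circle_haar))"

end

theory Submission
  imports Defs "HOL-Complex_Analysis.Cauchy_Integral_Formula" "HOL-Computational_Algebra.Field_as_Ring"
begin

text \<open>
  Put \<open>p = 2n + 1\<close>. Since the Galois group permutes the primitive
  \<open>p\<close>-th roots of unity transitively, the conjugates of \<open>\<alpha>\<^sub>n\<close> are the \<open>n\<close> numbers \<open>w + 1/w\<close> with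
  \<open>w\<^sup>p = 1\<close>, \<open>w \<noteq> 1\<close>, and their absolute values are \<open>2 cos (\<pi>j/p)\<close> for \<open>j = 1, \<dots>, n\<close>. So
  \<open>m(\<alpha>\<^sub>n)\<close> is the sum of \<open>log (2 cos (\<pi>j/p))\<close> over \<open>1 \<le> j \<le> p/3\<close>, which is \<open>p\<close> times a
  Riemann sum with step \<open>1/p\<close>. The transitivity is an Eisenstein argument: in the variable
  \<open>y = w + 1/w - 2\<close> the sum \<open>w\<^sup>-\<^sup>n + \<dots> + w\<^sup>n\<close> is a monic integer polynomial with constant
  term \<open>p\<close> and with all lower coefficients divisible by \<open>p\<close> (\<open>dirichlet_poly_irreducible\<close>,
  \<open>conjugates_alpha\<close>).

  The integrand \<open>log (2 cos \<pi>t)\<close> has a Lipschitz derivative on \<open>[0, 1/3]\<close>, so the trapezoid rule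
  is accurate to \<open>O(1/p\<^sup>2)\<close> there. It gives half weight to the left end, where the
  integrand is \<open>log 2\<close>, while the sum omits that end altogether: this is the source of
  the term \<open>- (log 2)/2\<close>. At the right end the integrand vanishes, so the fact that \<open>p/3\<close> is
  not an integer costs only another \<open>O(1/p\<^sup>2)\<close> in the integral and \<open>O(1/p)\<close> in the sum. Multiplying
  by \<open>p\<close> gives \<open>m(\<alpha>\<^sub>n) = p H - (log 2)/2 + O(1/p)\<close> with
  \<open>H = \<integral> log (2 cos \<pi>t) dt\<close> over \<open>[0, 1/3]\<close> (\<open>sum_log_cos_asymp\<close>).

  On the other side, Jensen's formula evaluates the inner integral of \<open>m(C\<^sub>2)\<close>:
  integrating \<open>log |x\<^sub>0 + a|\<close> over the circle gives \<open>max 0 (log |a|)\<close>. What remains is the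
  integral of \<open>max 0 (log |2 cos 2\<pi>t|)\<close> over a period, and by symmetry this is \<open>2 H\<close> (\<open>mC2_eq\<close>).
  With \<open>p = 2n + 1\<close> the term \<open>p H\<close> is \<open>m(C\<^sub>2) n + m(C\<^sub>2)/2\<close>.
\<close>


section \<open>Irreducible rational polynomials\<close>

lemma clear_denominators:
  fixes f :: "rat poly"
  obtains d :: int and F :: "int poly"
    where "d > 0" "map_poly of_int F = smult (of_int d) f"
proof -
  have "\<exists>d F. d > 0 \<and> map_poly of_int F = smult (of_int d) f"
  proof (induction f)
    case 0
    show ?case by (rule exI[of _ 1], rule exI[of _ 0]) simp
  next
    case (pCons a f)
    then obtain d F where dF: "d > 0" "map_poly of_int F = smult (of_int d) f" by blast
    obtain r s where rs: "quotient_of a = (r, s)" by (cases "quotient_of a")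
    have s: "s > 0" and a: "a = of_int r / of_int s"
      using quotient_of_denom_pos[OF rs] quotient_of_div[OF rs] by auto
    have "map_poly of_int (pCons (r * d) (smult s F)) = smult (of_int (d * s)) (pCons a f)"
      using dF s a by (intro poly_eqI) (auto simp: coeff_map_poly coeff_pCons poly_eq_iff split: nat.splits)
    then show ?case using dF s by (metis mult_pos_pos)
  qed
  then show ?thesis using that by blast
qed

text \<open>
  The first coefficient of \<open>F\<close> not divisible by \<open>p\<close>, at index \<open>i\<close>, meets the constant term
  of \<open>G\<close> in the coefficient of \<open>F * G\<close> at \<open>i\<close>. If \<open>p\<close> does not divide that constant term either, then
  \<open>p\<close> does not divide this coefficient, so \<open>i\<close> is already the degree of the product and nothing is
  left for \<open>G\<close>. Since \<open>p\<^sup>2\<close> does not divide the constant term of the product, one of the two factors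
  can play the part of \<open>G\<close>.
\<close>
lemma eisenstein_int:
  fixes F G :: "int poly" and p :: int
  assumes p: "prime p" and lead: "\<not> p dvd lead_coeff (F * G)"
    and low: "\<And>i. i < degree (F * G) \<Longrightarrow> p dvd coeff (F * G) i"
    and const: "\<not> p\<^sup>2 dvd coeff (F * G) 0"
  shows "degree F = 0 \<or> degree G = 0"
proof -
  have step: "degree B = 0"
    if AB: "A * B = F * G" and B0: "\<not> p dvd coeff B 0" for A B :: "int poly"
  proof -
    have "\<not> p dvd lead_coeff A"
      using lead unfolding AB[symmetric] lead_coeff_mult by auto
    define i where "i = (LEAST i. \<not> p dvd coeff A i)"
    have i: "\<not> p dvd coeff A i"
      unfolding i_def by (rule LeastI) fact
    have below: "p dvd coeff A j" if "j < i" for j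
      using not_less_Least that unfolding i_def by blast
    have "i \<le> degree A" by (rule le_degree) (use i in auto)
    have "coeff (A * B) i = (\<Sum>j<i. coeff A j * coeff B (i - j)) + coeff A i * coeff B 0"
      unfolding coeff_mult by (simp add: lessThan_Suc_atMost[symmetric])
    moreover have "p dvd (\<Sum>j<i. coeff A j * coeff B (i - j))"
      using below by (intro dvd_sum) auto
    moreover have "\<not> p dvd coeff A i * coeff B 0"
      using i B0 p prime_dvd_mult_iff by blast
    ultimately have "\<not> p dvd coeff (A * B) i"
      using dvd_add_right_iff by metis
    then have "degree (A * B) \<le> i"
      using low AB by (metis not_less)
    moreover have "A \<noteq> 0" "B \<noteq> 0"
      using i B0 by auto
    ultimately show ?thesis
      using \<open>i \<le> degree A\<close> by (simp add: degree_mult_eq)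
  qed
  have "\<not> p dvd coeff G 0 \<or> \<not> p dvd coeff F 0"
  proof (rule ccontr)
    assume "\<not> ?thesis"
    then have "p * p dvd coeff F 0 * coeff G 0" by (intro mult_dvd_mono) auto
    then show False using const by (simp add: coeff_mult_0 power2_eq_square)
  qed
  then show ?thesis
    using step[of F G] step[of G F] by (auto simp: mult.commute)
qed

lemma map_poly_of_int_mult:
  "(map_poly of_int (F * G) :: 'a :: comm_ring_1 poly) = map_poly of_int F * map_poly of_int G"
  by (rule poly_eqI) (simp add: coeff_map_poly coeff_mult)

text \<open>
  A rational factorization can be made integral without changing degrees: clear the denominators and
  pass to primitive parts, which multiply by Gauss's lemma. A monic polynomial is
  its own primitive part.
\<close>
lemma eisenstein_rat:
  fixes W :: "int poly" and p :: int
  assumes p: "prime p" and lead: "lead_coeff W = 1" and deg: "degree W > 0"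
    and low: "\<And>i. i < degree W \<Longrightarrow> p dvd coeff W i"
    and const: "\<not> p\<^sup>2 dvd coeff W 0"
  shows "irreducible (map_poly of_int W :: rat poly)"
proof (rule irreducibleI)
  let ?W = "map_poly of_int W :: rat poly"
  have degW: "degree ?W = degree W" by (rule degree_map_poly) auto
  show W0: "?W \<noteq> 0" "\<not> ?W dvd 1"
  proof -
    show "?W \<noteq> 0" using deg degW by fastforce
    then show "\<not> ?W dvd 1" using deg degW by (simp add: is_unit_iff_degree)
  qed
  fix f g assume fg: "?W = f * g"
  obtain d F where F: "d > 0" "map_poly of_int F = smult (of_int d) f" using clear_denominators .
  obtain e G where G: "e > 0" "map_poly of_int G = smult (of_int e) g" using clear_denominators .
  have "map_poly rat_of_int (F * G) = map_poly of_int (smult (d * e) W)"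
    by (simp add: map_poly_of_int_mult F G map_poly_smult fg mult.commute)
  then have FG: "F * G = smult (d * e) W"
    unfolding poly_eq_iff coeff_map_poly[of rat_of_int, OF of_int_0] of_int_eq_iff .
  have "content W dvd lead_coeff W" by (rule content_dvd_coeff)
  then have "content W = 1"
    using lead by (metis normalize_content is_unit_normalize)
  then have "primitive_part F * primitive_part G = W"
    using arg_cong[OF FG, of primitive_part] F(1) G(1)
    by (simp add: primitive_part_mult primitive_part_smult primitive_part_prim)
  then have "degree (primitive_part F) = 0 \<or> degree (primitive_part G) = 0"
    using eisenstein_int[of p "primitive_part F" "primitive_part G"] p lead low const
      not_prime_unit by auto
  moreover have "degree (map_poly rat_of_int F) = degree F" "degree (map_poly rat_of_int G) = degree G"
    by (auto intro: degree_map_poly)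
  ultimately have "degree f = 0 \<or> degree g = 0"
    using F G by auto
  moreover have "f \<noteq> 0" "g \<noteq> 0" using W0 fg by auto
  ultimately show "f dvd 1 \<or> g dvd 1" by (simp add: is_unit_iff_degree)
qed

text \<open>
  The substitution \<open>x \<mapsto> x + c\<close> is an automorphism of the polynomial ring.
\<close>
lemma irreducible_pcompose_shift:
  fixes P :: "'a :: field poly"
  assumes "irreducible P"
  shows "irreducible (pcompose P [:c, 1:])"
proof (rule irreducibleI)
  have inv: "pcompose (pcompose f [:c, 1:]) [:- c, 1:] = f" for f :: "'a poly"
    unfolding pcompose_assoc[symmetric] by (simp add: pcompose_pCons)
  have P: "P \<noteq> 0" "\<not> P dvd 1" using assms by (auto simp: irreducible_def)
  then show nz: "pcompose P [:c, 1:] \<noteq> 0" "\<not> pcompose P [:c, 1:] dvd 1"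
    by (auto simp: is_unit_iff_degree pcompose_eq_0_iff degree_pcompose)
  fix f g assume fg: "pcompose P [:c, 1:] = f * g"
  have "P = pcompose f [:- c, 1:] * pcompose g [:- c, 1:]"
    using arg_cong[OF fg, of "\<lambda>f. pcompose f [:- c, 1:]"] by (simp add: inv pcompose_mult)
  then have "pcompose f [:- c, 1:] dvd 1 \<or> pcompose g [:- c, 1:] dvd 1"
    using assms by (rule irreducibleD[rotated])
  moreover have "f \<noteq> 0" "g \<noteq> 0" using nz fg by auto
  ultimately show "f dvd 1 \<or> g dvd 1"
    by (auto simp: is_unit_iff_degree pcompose_eq_0_iff degree_pcompose)
qed

lemma map_poly_of_rat_add:
  "(map_poly of_rat (f + g) :: 'a :: field_char_0 poly) = map_poly of_rat f + map_poly of_rat g"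
  by (rule poly_eqI) (simp add: coeff_map_poly of_rat_add)

lemma map_poly_of_rat_mult:
  "(map_poly of_rat (f * g) :: 'a :: field_char_0 poly) = map_poly of_rat f * map_poly of_rat g"
  by (rule poly_eqI) (simp add: coeff_map_poly coeff_mult of_rat_sum of_rat_mult)

text \<open>
  Otherwise \<open>f\<close> and \<open>g\<close> are coprime over the rationals, and a Bezout identity evaluated at the
  common complex root \<open>a\<close> reads \<open>0 = 1\<close>.
\<close>
lemma irreducible_rat_poly_dvd:
  fixes f g :: "rat poly" and a :: complex
  assumes "irreducible f" "poly (map_poly of_rat f) a = 0" "poly (map_poly of_rat g) a = 0"
  shows "f dvd g"
proof (rule ccontr)
  assume "\<not> f dvd g"
  then have "Rings.coprime f g"
    using prime_elem_imp_coprime[OF irreducible_imp_prime_elem[OF assms(1)]] by blast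
  moreover obtain u v where "bezout_coefficients f g = (u, v)" by fastforce
  ultimately have "u * f + v * g = 1"
    using bezout_coefficients[of f g u v] by simp
  then have "poly (map_poly of_rat (u * f + v * g)) a = 1" by simp
  then show False
    using assms by (simp add: map_poly_of_rat_add map_poly_of_rat_mult)
qed

text \<open>
  A minimal polynomial divides every other one, so all of them have the same roots and any
  single one computes the set of conjugates.
\<close>
lemma conjugates_eq_roots:
  assumes "is_min_poly P a"
  shows "conjugates a = {b. poly (map_poly of_rat P) b = 0}"
proof -
  have "poly (map_poly of_rat P) b = 0"
    if "is_min_poly f a" "poly (map_poly of_rat f) b = 0" for f b
  proof -
    have "f dvd P"
      using irreducible_rat_poly_dvd[of f a P] that(1) assms by (auto simp: is_min_poly_def)
    then obtain h where "P = f * h" ..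
    then show ?thesis using that(2) by (simp add: map_poly_of_rat_mult)
  qed
  then show ?thesis using assms unfolding conjugates_def by blast
qed


section \<open>The minimal polynomial of \<open>\<zeta> + 1/\<zeta>\<close>\<close>

text \<open>
  The Dirichlet kernel \<open>w\<^sup>-\<^sup>n + \<dots> + w\<^sup>n\<close> as a polynomial in \<open>y = w + 1/w - 2\<close>. The recurrence comes
  from multiplying the kernel by \<open>w + 1/w = y + 2\<close>. Centering at \<open>2 = 1 + 1/1\<close> is what makes Eisenstein's
  criterion applicable, because all roots of unity of order \<open>p\<close> reduce to \<open>1\<close> modulo
  a prime ideal above \<open>p\<close>.
\<close>
fun dirichlet_poly :: "nat \<Rightarrow> int poly" where
  "dirichlet_poly 0 = 1"
| "dirichlet_poly (Suc 0) = [:3, 1:]"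
| "dirichlet_poly (Suc (Suc n)) = [:2, 1:] * dirichlet_poly (Suc n) - dirichlet_poly n"

lemma coeff_dirichlet_poly:
  "coeff (dirichlet_poly n) j = int (((n + j) choose (2 * j)) + 2 * ((n + j) choose (2 * j + 1)))"
proof (induction n arbitrary: j rule: dirichlet_poly.induct)
  case 1
  have "j choose (2 * j) = (if j = 0 then 1 else 0)" by (simp add: binomial_eq_0)
  then show ?case by (simp add: coeff_1 binomial_eq_0)
next
  case 2
  consider "j = 0" | "j = 1" | "j \<ge> 2" by linarith
  then show ?case
    by cases (auto simp: coeff_pCons binomial_eq_0 numeral_2_eq_2 split: nat.splits)
next
  case (3 n)
  show ?case
  proof (cases j)
    case 0
    then show ?thesis using 3 by (simp add: coeff_mult_0)
  next
    case (Suc i)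
    have "coeff (dirichlet_poly (Suc (Suc n))) j =
        2 * coeff (dirichlet_poly (Suc n)) j + coeff (dirichlet_poly (Suc n)) i - coeff (dirichlet_poly n) j"
      using Suc by (simp add: mult_pCons_left)
    then show ?thesis unfolding 3 Suc by (simp add: numeral_eq_Suc)
  qed
qed

lemma dirichlet_poly_degree: "degree (dirichlet_poly n) = n"
  and dirichlet_poly_lead: "lead_coeff (dirichlet_poly n) = 1"
proof -
  have "coeff (dirichlet_poly n) n = 1" by (simp add: coeff_dirichlet_poly mult_2[symmetric] binomial_eq_0)
  moreover have "coeff (dirichlet_poly n) j = 0" if "j > n" for j
    using that by (simp add: coeff_dirichlet_poly binomial_eq_0)
  ultimately show "degree (dirichlet_poly n) = n"
    by (intro antisym degree_le le_degree) auto
  then show "lead_coeff (dirichlet_poly n) = 1" using \<open>coeff (dirichlet_poly n) n = 1\<close> by simp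
qed

text \<open>
  The coefficient is \<open>(2n + 1)/(2j + 1)\<close> times a binomial coefficient. Clearing the
  denominator \<open>2j + 1\<close>, which is smaller than \<open>2n + 1\<close> below the leading term, shows
  divisibility by \<open>2n + 1\<close> when this is prime.
\<close>
lemma dirichlet_poly_coeff_times:
  assumes "j \<le> n"
  shows "(2 * int j + 1) * coeff (dirichlet_poly n) j = (2 * int n + 1) * int ((n + j) choose (2 * j))"
proof -
  have "Suc (2 * j) * ((n + j) choose Suc (2 * j)) = (n - j) * ((n + j) choose (2 * j))"
    using binomial_absorb_comp[of "n + j" "2 * j"] binomial_absorption[of "2*j" "n+j"] assms
    by simp
  then have "int (Suc (2 * j)) * int ((n + j) choose Suc (2 * j)) = (int n - int j) * int ((n + j) choose (2 * j))"
    using assms by (metis of_nat_diff of_nat_mult)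
  then show ?thesis unfolding coeff_dirichlet_poly by (simp add: algebra_simps)
qed

lemma dirichlet_poly_irreducible:
  assumes p: "prime (2 * n + 1)" and n: "n > 0"
  shows "irreducible (map_poly of_int (dirichlet_poly n) :: rat poly)"
proof (rule eisenstein_rat[where p = "2 * int n + 1"])
  have "prime (int (2 * n + 1))" using p by (simp only: prime_nat_int_transfer)
  then show pr: "prime (2 * int n + 1)" by (simp only: of_nat_add of_nat_mult of_nat_numeral of_nat_1)
  show "degree (dirichlet_poly n) > 0" "lead_coeff (dirichlet_poly n) = 1"
    using n dirichlet_poly_degree[of n] dirichlet_poly_lead[of n] by simp_all
  show "2 * int n + 1 dvd coeff (dirichlet_poly n) i" if "i < degree (dirichlet_poly n)" for i
  proof -
    have i: "i < n" using that by (simp add: dirichlet_poly_degree)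
    then have "2 * int n + 1 dvd (2 * int i + 1) * coeff (dirichlet_poly n) i"
      by (simp add: dirichlet_poly_coeff_times)
    moreover have "\<not> 2 * int n + 1 dvd 2 * int i + 1"
      using i by (auto dest: zdvd_imp_le)
    ultimately show ?thesis using pr prime_dvd_mult_iff by blast
  qed
  have "coeff (dirichlet_poly n) 0 = 2 * int n + 1" using coeff_dirichlet_poly[of n 0] by simp
  moreover have "\<not> (2 * int n + 1)\<^sup>2 dvd 2 * int n + 1"
    using n by (intro zdvd_not_zless) (auto simp: power2_eq_square)
  ultimately show "\<not> (2 * int n + 1)\<^sup>2 dvd coeff (dirichlet_poly n) 0" by simp
qed

text \<open>
  Multiplied by \<open>w\<^sup>n\<close>, the kernel becomes the geometric sum \<open>1 + w + \<dots> + w\<^sup>2\<^sup>n\<close>. So the roots are the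
  values of \<open>w + 1/w - 2\<close> at the nontrivial roots of unity of order dividing \<open>2n + 1\<close>.
\<close>
lemma dirichlet_poly_eval:
  fixes w :: complex
  assumes "w \<noteq> 0"
  shows "(w - 1) * w ^ n * poly (map_poly of_int (dirichlet_poly n)) (w + inverse w - 2) = w ^ (2 * n + 1) - 1"
proof (induction n rule: dirichlet_poly.induct)
  case 1
  then show ?case by simp
next
  case 2
  have "(w - 1) * w * (3 + (w + inverse w - 2)) = (w - 1) * (w * w + w + w * inverse w)"
    by (simp add: algebra_simps)
  then show ?case using assms by (simp add: map_poly_pCons algebra_simps power3_eq_cube)
next
  case (3 n)
  let ?y = "w + inverse w - 2"
  let ?V = "\<lambda>n. poly (map_poly of_int (dirichlet_poly n)) ?y"
  have "map_poly of_int (dirichlet_poly (Suc (Suc n))) =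
      [:2, 1:] * map_poly complex_of_int (dirichlet_poly (Suc n)) - map_poly of_int (dirichlet_poly n)"
    by (rule poly_eqI) (simp add: coeff_map_poly coeff_mult mult_pCons_left coeff_pCons split: nat.splits)
  from arg_cong[OF this, of "\<lambda>q. poly q ?y"]
  have rec: "?V (Suc (Suc n)) = (w + inverse w) * ?V (Suc n) - ?V n"
    by (simp del: dirichlet_poly.simps add: algebra_simps)
  have s: "w * (w + inverse w) = w * w + 1" using assms by (simp add: algebra_simps)
  have "(w - 1) * (w * (w * x)) * (t * v - u) = (w * t) * ((w - 1) * (w * x) * v) - w * w * ((w - 1) * x * u)"
    for x t u v
    by (simp add: algebra_simps)
  then have "(w - 1) * w ^ Suc (Suc n) * ?V (Suc (Suc n)) =
     (w * w + 1) * ((w - 1) * w ^ Suc n * ?V (Suc n)) - w * w * ((w - 1) * w ^ n * ?V n)"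
    unfolding rec power_Suc s[symmetric] .
  also have "\<dots> = w ^ (2 * Suc (Suc n) + 1) - 1"
    unfolding 3 by (simp add: algebra_simps power_add power2_eq_square)
  finally show ?case .
qed

lemma poly_map_poly_of_rat_pcompose:
  fixes x :: "'a :: field_char_0"
  shows "poly (map_poly of_rat (pcompose f g)) x = poly (map_poly of_rat f) (poly (map_poly of_rat g) x)"
  by (induction f)
     (simp_all add: pcompose_pCons map_poly_of_rat_add map_poly_of_rat_mult map_poly_pCons)

definition two_cos_poly :: "nat \<Rightarrow> rat poly" where
  "two_cos_poly n = pcompose (map_poly of_int (dirichlet_poly n)) [:- 2, 1:]"

lemma two_cos_poly_eval:
  "poly (map_poly of_rat (two_cos_poly n)) x = poly (map_poly of_int (dirichlet_poly n)) (x - 2 :: complex)"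
proof -
  have "map_poly of_rat (map_poly rat_of_int (dirichlet_poly n)) = (map_poly of_int (dirichlet_poly n) :: complex poly)"
    by (rule poly_eqI) (simp add: coeff_map_poly)
  then show ?thesis
    unfolding two_cos_poly_def poly_map_poly_of_rat_pcompose by (simp add: map_poly_pCons of_rat_minus)
qed

lemma two_cos_poly_degree: "degree (two_cos_poly n) = n"
  and two_cos_poly_lead: "lead_coeff (two_cos_poly n) = 1"
proof -
  have d: "degree (map_poly rat_of_int (dirichlet_poly n)) = n"
    using dirichlet_poly_degree by (subst degree_map_poly) auto
  then show "degree (two_cos_poly n) = n" by (simp add: two_cos_poly_def degree_pcompose)
  show "lead_coeff (two_cos_poly n) = 1"
    using dirichlet_poly_lead[of n] dirichlet_poly_degree[of n] d by (simp add: two_cos_poly_def lead_coeff_comp coeff_map_poly)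
qed

lemma two_cos_poly_root_iff:
  fixes w :: complex
  assumes "w \<noteq> 0" "w \<noteq> 1"
  shows "poly (map_poly of_rat (two_cos_poly n)) (w + inverse w) = 0 \<longleftrightarrow> w ^ (2 * n + 1) = 1"
  using dirichlet_poly_eval[OF assms(1), of n] assms unfolding two_cos_poly_eval by auto

lemma cis_add_inverse: "cis x + inverse (cis x) = of_real (2 * cos x)"
  by (simp add: complex_eq_iff)

lemma abs_cos_half_turns: "\<bar>cos (real j * pi + x)\<bar> = \<bar>cos x\<bar>"
proof -
  have "cos (real j * pi + x) = (- 1) ^ j * cos x"
    by (simp add: cos_add mult.commute[of _ pi])
  then show ?thesis by (simp add: abs_mult power_abs)
qed


section \<open>The conjugates of \<open>\<alpha>\<^sub>n\<close>\<close>

text \<open>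
  With \<open>p = 2n + 1\<close>, each conjugate is \<open>w + 1/w\<close> for \<open>w = \<zeta>\<close> raised to \<open>j (n + 1)\<close>. As \<open>n + 1\<close> is the inverse of
  \<open>2\<close> modulo \<open>p\<close>, this is a relabelling of the usual list: the angle of \<open>w\<close> is
  \<open>\<pi>j + \<pi>j/p\<close>, so the conjugate is \<open>2 cos (\<pi>j/p)\<close> up to sign. In this labelling
  the absolute values decrease strictly in \<open>j\<close>. So the \<open>n\<close> values are distinct, and they exhaust the
  roots of a polynomial of degree \<open>n\<close>.
\<close>
lemma conjugates_alpha:
  assumes p: "prime (2 * n + 1)" and n: "n > 0"
  defines "c \<equiv> \<lambda>j. 2 * cos (real j * (2 * pi * real (n + 1) / real (2 * n + 1)))"
  shows "conjugates (alpha n) = (\<lambda>j. of_real (c j)) ` {1..n}"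
    and "j \<in> {1..n} \<Longrightarrow> \<bar>c j\<bar> = 2 * cos (pi * real j / real (2 * n + 1))"
    and "inj_on (\<lambda>j. complex_of_real (c j)) {1..n}"
proof -
  define x where "x = 2 * pi * real (n + 1) / real (2 * n + 1)"
  have x: "x = pi + pi / real (2 * n + 1)" by (simp add: x_def field_simps)
  show abs_c: "\<bar>c j\<bar> = 2 * cos (pi * real j / real (2 * n + 1))" if "j \<in> {1..n}" for j
  proof -
    have "pi * (2 * real j) \<le> pi * real (2 * n + 1)" using that by (intro mult_left_mono) auto
    then have "pi * real j / real (2 * n + 1) \<le> pi / 2"
      by (simp add: field_simps)
    then have "cos (pi * real j / real (2 * n + 1)) \<ge> 0"
      by (intro cos_ge_zero) (auto intro: order_trans[of _ 0])
    moreover have "c j = 2 * cos (real j * pi + pi * real j / real (2 * n + 1))"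
      unfolding c_def x_def[symmetric] x by (simp only: distrib_left times_divide_eq_right mult.commute)
    ultimately show ?thesis using abs_cos_half_turns[of j] by (simp add: abs_mult)
  qed
  have mono: "cos (pi * real j / real (2 * n + 1)) < cos (pi * real i / real (2 * n + 1))"
    if "i < j" "j \<le> n" for i j
  proof (rule cos_monotone_0_pi)
    have "pi * real j \<le> pi * real (2 * n + 1)"
      using that by (intro mult_left_mono) auto
    then show "pi * real j / real (2 * n + 1) \<le> pi" by (simp add: field_simps)
    show "pi * real i / real (2 * n + 1) < pi * real j / real (2 * n + 1)"
      using that by (intro divide_strict_right_mono mult_strict_left_mono) auto
  qed auto
  show inj: "inj_on (\<lambda>j. complex_of_real (c j)) {1..n}"
  proof (rule linorder_inj_onI')
    fix i j assume ij: "i \<in> {1..n}" "j \<in> {1..n}" "i < j"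
    then have "\<bar>c j\<bar> < \<bar>c i\<bar>" using mono[of i j] by (simp add: abs_c)
    then show "complex_of_real (c i) \<noteq> complex_of_real (c j)" by auto
  qed
  have c: "of_real (c j) = cis (real j * x) + inverse (cis (real j * x))" for j
    unfolding cis_add_inverse c_def x_def by simp
  have x_pow: "cis (real j * x) ^ (2 * n + 1) = 1" for j
  proof -
    have "real (2 * n + 1) * (real j * x) = 2 * pi * real (j * (n + 1))"
      unfolding x_def of_nat_mult[of j "n + 1"] by (simp del: of_nat_add)
    then have "cis (real j * x) ^ (2 * n + 1) = cis (2 * pi * real (j * (n + 1)))"
      using Complex.DeMoivre[of "real j * x" "2 * n + 1"] by (simp only:)
    also have "\<dots> = 1" by (rule cis_multiple_2pi) (rule Ints_of_nat)
    finally show ?thesis .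
  qed
  have x_neq_1: "cis (real j * x) \<noteq> 1" if "j \<in> {1..n}" for j
  proof
    assume "cis (real j * x) = 1"
    then have "complex_of_real (c j) = 2" unfolding c by simp
    then have "c j = 2" by (metis of_real_eq_iff of_real_numeral)
    then show False using abs_c[OF that] mono[of 0 j] that by simp
  qed
  \<comment> \<open>If the given primitive root were \<open>1\<close>, then so would be its power \<open>cis x\<close>, the case \<open>j = 1\<close>.\<close>
  have zeta: "zeta (2 * n + 1) = cis (2 * pi / real (2 * n + 1))"
    by (simp add: zeta_def cis_conv_exp mult.commute mult.left_commute)
  have "zeta (2 * n + 1) ^ (n + 1) = cis (real (n + 1) * (2 * pi / real (2 * n + 1)))"
    unfolding zeta by (rule Complex.DeMoivre)
  also have "real (n + 1) * (2 * pi / real (2 * n + 1)) = real 1 * x"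
    by (simp add: x_def)
  finally have "zeta (2 * n + 1) \<noteq> 1"
    using x_neq_1[of 1] n by (metis One_nat_def atLeastAtMost_iff Suc_leI order_refl power_one)
  moreover have "zeta (2 * n + 1) ^ (2 * n + 1) = 1"
    unfolding zeta Complex.DeMoivre by simp
  ultimately have "poly (map_poly of_rat (two_cos_poly n)) (alpha n) = 0"
    unfolding alpha_def by (subst two_cos_poly_root_iff) (auto simp: zeta)
  moreover have "irreducible (two_cos_poly n)"
    unfolding two_cos_poly_def by (intro irreducible_pcompose_shift dirichlet_poly_irreducible p n)
  ultimately have "is_min_poly (two_cos_poly n) (alpha n)"
    unfolding is_min_poly_def using two_cos_poly_lead by blast
  then have conj: "conjugates (alpha n) = {b. poly (map_poly of_rat (two_cos_poly n)) b = 0}"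
    by (rule conjugates_eq_roots)
  let ?q = "map_poly of_rat (two_cos_poly n) :: complex poly"
  have degq: "degree ?q = n" using two_cos_poly_degree by (subst degree_map_poly) auto
  then have q0: "?q \<noteq> 0" using n by auto
  have sub: "(\<lambda>j. of_real (c j)) ` {1..n} \<subseteq> {b. poly ?q b = 0}"
  proof (intro image_subsetI CollectI)
    fix j assume j: "j \<in> {1..n}"
    show "poly ?q (of_real (c j)) = 0"
      unfolding c by (intro two_cos_poly_root_iff[THEN iffD2] cis_neq_zero x_neq_1 x_pow j)
  qed
  moreover have "card ((\<lambda>j. complex_of_real (c j)) ` {1..n}) = n"
    using inj by (simp add: card_image)
  ultimately show "conjugates (alpha n) = (\<lambda>j. of_real (c j)) ` {1..n}"
    unfolding conj using card_poly_roots_bound[OF q0] degq poly_roots_finite[OF q0]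
    by (metis card_seteq)
qed

lemma mahler_alpha:
  assumes "prime (2 * n + 1)" "n > 0"
  shows "mahler (alpha n) = (\<Sum>j=1..n. max 0 (ln (2 * cos (pi * real j / real (2 * n + 1)))))"
proof -
  have "mahler (alpha n) =
      (\<Sum>j=1..n. max 0 (ln \<bar>2 * cos (real j * (2 * pi * real (n + 1) / real (2 * n + 1)))\<bar>))"
    unfolding mahler_def conjugates_alpha(1)[OF assms]
    by (subst sum.reindex[OF conjugates_alpha(3)[OF assms]]) (simp only: o_def norm_of_real)
  also have "\<dots> = (\<Sum>j=1..n. max 0 (ln (2 * cos (pi * real j / real (2 * n + 1)))))"
    using conjugates_alpha(2)[OF assms] by (intro sum.cong) (simp_all only:)
  finally show ?thesis .
qed


section \<open>The trapezoid rule for functions with Lipschitz derivative\<close>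

text \<open>
  For each \<open>x\<close>, the slopes of the secant from \<open>a\<close> to \<open>x\<close> and of the chord from \<open>a\<close> to \<open>b\<close> are both
  values of \<open>f'\<close>, hence differ by at most \<open>V\<close>. So \<open>f\<close> stays within \<open>V (b - a)\<close> of the chord, whose
  integral is the trapezoid.
\<close>
lemma trapezoid_error:
  fixes f f' :: "real \<Rightarrow> real"
  assumes ab: "a < b" and cont: "continuous_on {a..b} f"
    and der: "\<And>x. a < x \<Longrightarrow> x < b \<Longrightarrow> (f has_real_derivative f' x) (at x)"
    and osc: "\<And>x y. a < x \<Longrightarrow> x < b \<Longrightarrow> a < y \<Longrightarrow> y < b \<Longrightarrow> \<bar>f' x - f' y\<bar> \<le> V"
  shows "\<bar>integral {a..b} f - (b - a) * (f a + f b) / 2\<bar> \<le> V * (b - a)\<^sup>2"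
proof -
  have mvt: "\<exists>z. a < z \<and> z < b \<and> f x - f a = (x - a) * f' z" if "a < x" "x \<le> b" for x
  proof -
    have "\<exists>l z. a < z \<and> z < x \<and> (f has_real_derivative l) (at z) \<and> f x - f a = (x - a) * l"
    proof (intro MVT continuous_on_subset[OF cont])
      fix y assume "a < y" "y < x"
      then show "f differentiable (at y)"
        using der[of y] that by (auto simp: real_differentiable_def)
    qed (use that in auto)
    then obtain l z where z: "a < z" "z < x" "(f has_real_derivative l) (at z)" "f x - f a = (x - a) * l"
      by blast
    moreover have "l = f' z" using z der[of z] that by (metis DERIV_unique less_le_trans)
    ultimately show ?thesis using that by fastforce
  qed
  obtain \<eta> where \<eta>: "a < \<eta>" "\<eta> < b" "f b - f a = (b - a) * f' \<eta>" using mvt[of b] ab by auto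
  have V: "V \<ge> 0" using osc[of \<eta> \<eta>] \<eta> by simp
  define L where "L x = f a + (x - a) * f' \<eta>" for x
  have close: "\<bar>f x - L x\<bar> \<le> V * (b - a)" if "x \<in> {a..b}" for x
  proof (cases "x = a")
    case True
    then show ?thesis using V ab by (simp add: L_def)
  next
    case False
    then have "a < x" "x \<le> b" using that by auto
    then obtain z where z: "a < z" "z < b" "f x - f a = (x - a) * f' z"
      using mvt by blast
    then have "f x - L x = (x - a) * (f' z - f' \<eta>)" by (simp add: L_def algebra_simps)
    then have "\<bar>f x - L x\<bar> = (x - a) * \<bar>f' z - f' \<eta>\<bar>" using that by (simp add: abs_mult)
    also have "\<dots> \<le> (b - a) * V" using that z \<eta> osc by (intro mult_mono) auto
    finally show ?thesis by (simp add: mult.commute)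
  qed
  have L: "(L has_integral (b - a) * (f a + f b) / 2) {a..b}"
  proof -
    have "(L has_integral (f a * b + (b - a)\<^sup>2 / 2 * f' \<eta>) - (f a * a + (a - a)\<^sup>2 / 2 * f' \<eta>)) {a..b}"
      using ab unfolding L_def
      by (intro fundamental_theorem_of_calculus)
         (auto intro!: derivative_eq_intros simp flip: has_real_derivative_iff_has_vector_derivative)
    moreover have "(f a * b + (b - a)\<^sup>2 / 2 * f' \<eta>) - (f a * a + (a - a)\<^sup>2 / 2 * f' \<eta>)
        = f a * (b - a) + (b - a) * ((b - a) * f' \<eta>) / 2"
      by (simp add: power2_eq_square algebra_simps)
    moreover have "f a * (b - a) + (b - a) * ((b - a) * f' \<eta>) / 2 = (b - a) * (f a + f b) / 2"
      unfolding \<eta>(3)[symmetric] by (simp add: field_simps)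
    ultimately show ?thesis by (simp only:)
  qed
  have "(f has_integral integral {a..b} f) {a..b}"
    using cont by (intro integrable_integral integrable_continuous_interval)
  from has_integral_diff[OF this L]
  have "norm (integral {a..b} f - (b - a) * (f a + f b) / 2) \<le> V * (b - a) * measure lborel {a..b}"
    using close V ab by (intro has_integral_bound_real[where f = "\<lambda>x. f x - L x"]) auto
  then show ?thesis using ab by (simp add: power2_eq_square mult.assoc)
qed

lemma composite_trapezoid_error:
  fixes f f' :: "real \<Rightarrow> real"
  assumes d: "d > 0" and cont: "continuous_on {0..real m * d} f"
    and der: "\<And>x. 0 < x \<Longrightarrow> x < real m * d \<Longrightarrow> (f has_real_derivative f' x) (at x)"
    and lip: "\<And>x y. 0 < x \<Longrightarrow> x < real m * d \<Longrightarrow> 0 < y \<Longrightarrow> y < real m * d \<Longrightarrow> \<bar>f' x - f' y\<bar> \<le> M * \<bar>x - y\<bar>"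
    and M: "M \<ge> 0"
  shows "\<bar>integral {0..real m * d} f - d * ((\<Sum>k=1..m. f (real k * d)) + (f 0 - f (real m * d)) / 2)\<bar>
           \<le> real m * (M * d ^ 3)"
  using cont der lip
proof (induction m)
  case 0
  then show ?case by simp
next
  case (Suc m)
  define a b where "a = real m * d" and "b = real (Suc m) * d"
  have ab: "0 \<le> a" "a < b" "b - a = d" using d by (auto simp: a_def b_def algebra_simps)
  let ?E = "\<lambda>m. integral {0..real m * d} f - d * ((\<Sum>k=1..m. f (real k * d)) + (f 0 - f (real m * d)) / 2)"
  have IH: "\<bar>?E m\<bar> \<le> real m * (M * d ^ 3)"
    using Suc.prems ab unfolding a_def[symmetric] b_def[symmetric]
    by (intro Suc.IH[folded a_def] continuous_on_subset[OF Suc.prems(1)[folded b_def]]) auto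
  have "\<bar>integral {a..b} f - (b - a) * (f a + f b) / 2\<bar> \<le> (M * d) * (b - a)\<^sup>2"
  proof (rule trapezoid_error[where f' = f'])
    show "continuous_on {a..b} f"
      using ab by (intro continuous_on_subset[OF Suc.prems(1)[folded b_def]]) auto
    show "\<bar>f' x - f' y\<bar> \<le> M * d" if "a < x" "x < b" "a < y" "y < b" for x y
    proof -
      have "\<bar>f' x - f' y\<bar> \<le> M * \<bar>x - y\<bar>"
        using that ab by (intro Suc.prems(3)[folded b_def]) auto
      also have "\<dots> \<le> M * d" using that ab M by (intro mult_left_mono) auto
      finally show ?thesis .
    qed
  qed (use ab Suc.prems(2)[folded b_def] in auto)
  then have step: "\<bar>integral {a..b} f - d * (f a + f b) / 2\<bar> \<le> M * d ^ 3"
    using ab(3) by (simp add: power2_eq_square power3_eq_cube mult.assoc)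
  have "integral {0..b} f = integral {0..a} f + integral {a..b} f"
    using ab Suc.prems(1)[folded b_def]
    by (intro Henstock_Kurzweil_Integration.integral_combine[symmetric] integrable_continuous_interval) auto
  then have "?E (Suc m) = ?E m + (integral {a..b} f - d * (f a + f b) / 2)"
    unfolding a_def[symmetric] b_def[symmetric]
    using b_def[symmetric] by (simp add: field_simps del: of_nat_Suc)
  then have "\<bar>?E (Suc m)\<bar> \<le> \<bar>?E m\<bar> + \<bar>integral {a..b} f - d * (f a + f b) / 2\<bar>"
    by linarith
  also have "\<dots> \<le> real (Suc m) * (M * d ^ 3)"
    using IH step by (simp add: algebra_simps)
  finally show ?case .
qed


section \<open>The Riemann sum of \<open>log (2 cos \<pi>t)\<close>\<close>

definition log_cos :: "real \<Rightarrow> real" where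
  "log_cos t = ln (2 * cos (pi * t))"

lemma cos_ge_half:
  assumes "0 \<le> t" "t \<le> 1 / 3"
  shows "cos (pi * t) \<ge> 1 / 2"
proof -
  have "cos (pi / 3) \<le> cos (pi * t)"
    using assms by (intro cos_monotone_0_pi_le) (auto simp: field_simps)
  then show ?thesis by (simp add: cos_60)
qed

lemma log_cos_derivative:
  assumes "0 \<le> t" "t \<le> 1 / 3"
  shows "(log_cos has_real_derivative - pi * tan (pi * t)) (at t)"
  unfolding log_cos_def using cos_ge_half[OF assms]
  by (auto intro!: derivative_eq_intros simp: tan_def field_simps)

lemma log_cos_continuous: "continuous_on {0..1/3} log_cos"
  using DERIV_isCont[OF log_cos_derivative] by (intro continuous_at_imp_continuous_on) auto

lemma log_cos_derivative_lipschitz: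
  assumes "0 \<le> x" "x \<le> 1 / 3" "0 \<le> y" "y \<le> 1 / 3"
  shows "\<bar>- pi * tan (pi * x) - - pi * tan (pi * y)\<bar> \<le> 4 * pi\<^sup>2 * \<bar>x - y\<bar>"
proof -
  have "norm (- pi * tan (pi * x) - - pi * tan (pi * y)) \<le> 4 * pi\<^sup>2 * norm (x - y)"
  proof (rule field_differentiable_bound[where S = "{0..1/3}"])
    fix t :: real assume t: "t \<in> {0..1/3}"
    have c: "cos (pi * t) \<ge> 1 / 2" using cos_ge_half t by auto
    then show "((\<lambda>t. - pi * tan (pi * t)) has_field_derivative - pi * (inverse ((cos (pi * t))\<^sup>2) * pi))
        (at t within {0..1/3})"
      by (auto intro!: derivative_eq_intros)
    have "inverse ((cos (pi * t))\<^sup>2) \<le> inverse ((1 / 2)\<^sup>2)"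
      using c by (intro le_imp_inverse_le power_mono) auto
    then have "pi * pi * inverse ((cos (pi * t))\<^sup>2) \<le> pi * pi * 4"
      by (intro mult_left_mono) (auto simp: power2_eq_square)
    then show "norm (- pi * (inverse ((cos (pi * t))\<^sup>2) * pi)) \<le> 4 * pi\<^sup>2"
      by (simp add: abs_mult power2_eq_square mult_ac flip: abs_inverse)
  qed (use assms in auto)
  then show ?thesis by simp
qed

text \<open>
  The function \<open>log_cos\<close> vanishes at \<open>1/3\<close>, and its slope is at most \<open>2 \<pi>\<close> in absolute value.
  This controls the error from stopping the sum at the last multiple of \<open>1/p\<close> before \<open>1/3\<close>.
\<close>
lemma log_cos_near_third:
  assumes "0 \<le> t" "t \<le> 1 / 3"
  shows "0 \<le> log_cos t" "log_cos t \<le> 2 * pi * (1 / 3 - t)"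
proof -
  show pos: "0 \<le> log_cos t" unfolding log_cos_def using cos_ge_half[OF assms] by simp
  have "norm (log_cos t - log_cos (1 / 3)) \<le> 2 * pi * norm (t - 1 / 3)"
  proof (rule field_differentiable_bound[where S = "{0..1/3}"])
    fix s :: real assume s: "s \<in> {0..1/3}"
    then show "(log_cos has_field_derivative - pi * tan (pi * s)) (at s within {0..1/3})"
      using log_cos_derivative[of s] by (auto intro: DERIV_subset)
    have "\<bar>sin (pi * s)\<bar> \<le> 2 * cos (pi * s)" "cos (pi * s) > 0"
      using cos_ge_half[of s] s order_trans[OF abs_sin_le_one[of "pi * s"], of "2 * cos (pi * s)"] by auto
    then have "\<bar>tan (pi * s)\<bar> \<le> 2" by (simp add: tan_def field_simps)
    then show "norm (- pi * tan (pi * s)) \<le> 2 * pi" by (simp add: abs_mult)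
  qed (use assms in auto)
  moreover have "log_cos (1 / 3) = 0" using cos_60 by (simp add: log_cos_def)
  ultimately show "log_cos t \<le> 2 * pi * (1 / 3 - t)" using pos assms by simp
qed

text \<open>
  Only the indices up to \<open>m = \<lfloor>p/3\<rfloor>\<close> contribute, as \<open>2 cos (\<pi>j/p) \<le> 1\<close> beyond. On \<open>[0, m/p]\<close> the trapezoid
  rule applies, and the value at \<open>0\<close>, which it counts with weight one half, is \<open>log 2\<close>.
\<close>
lemma sum_log_cos_asymp:
  assumes n: "n > 0"
  shows "\<bar>(\<Sum>j=1..n. max 0 (ln (2 * cos (pi * real j / real (2 * n + 1)))))
           - (real (2 * n + 1) * integral {0..1/3} log_cos - ln 2 / 2)\<bar>
         \<le> (4 * pi\<^sup>2 + 3 * pi) / real n"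
proof -
  define p where "p = real (2 * n + 1)"
  define m where "m = (2 * n + 1) div 3"
  define d where "d = 1 / p"
  have p: "p > 0" "real n \<le> p" and d: "d > 0" by (auto simp: p_def d_def)
  have m: "m \<le> n" "3 * real m \<le> p" "p < 3 * real m + 3" "real m \<le> p"
  proof -
    have "3 * m \<le> 2 * n + 1" "2 * n + 1 < 3 * m + 3" unfolding m_def by auto
    then have "3 * real m \<le> real (2 * n + 1)" "real (2 * n + 1) < 3 * real m + 3" by linarith+
    then show "3 * real m \<le> p" "p < 3 * real m + 3" "real m \<le> p" unfolding p_def by linarith+
    show "m \<le> n" using n by (auto simp: m_def)
  qed
  have md: "real m * d \<le> 1 / 3" "1 / 3 - real m * d \<le> d" "0 \<le> real m * d"
    using m p by (auto simp: d_def divide_simps)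
  let ?S = "\<Sum>j=1..n. max 0 (ln (2 * cos (pi * real j / p)))"
  have S: "?S = (\<Sum>k=1..m. log_cos (real k * d))"
  proof (rule sum.mono_neutral_cong_right)
    show "\<forall>j\<in>{1..n} - {1..m}. max 0 (ln (2 * cos (pi * real j / p))) = 0"
    proof
      fix j assume j: "j \<in> {1..n} - {1..m}"
      then have "p \<le> 3 * real j" "2 * real j \<le> p" using m by (auto simp: p_def)
      then have "pi / 3 \<le> pi * real j / p" "pi * real j / p \<le> pi / 2"
        using p by (auto simp: field_simps)
      moreover from this have "pi * real j / p \<le> pi" using pi_gt_zero by linarith
      ultimately have "cos (pi * real j / p) \<le> cos (pi / 3)" "0 \<le> cos (pi * real j / p)"
        using pi_gt_zero by (auto intro!: cos_monotone_0_pi_le cos_ge_zero simp del: pi_gt_zero)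
      then have "0 \<le> 2 * cos (pi * real j / p)" "2 * cos (pi * real j / p) \<le> 1" by (simp_all add: cos_60)
      then have "ln (2 * cos (pi * real j / p)) \<le> 0"
        by (metis ln_le_zero_iff ln_0 order_le_less order_refl)
      then show "max 0 (ln (2 * cos (pi * real j / p))) = 0" by simp
    qed
    fix k assume k: "k \<in> {1..m}"
    then have "real k * d \<le> real m * d" using d by (intro mult_right_mono) auto
    then have "real k * d \<le> 1 / 3" using md by linarith
    then have "log_cos (real k * d) \<ge> 0" using d by (intro log_cos_near_third(1)) auto
    then show "max 0 (ln (2 * cos (pi * real k / p))) = log_cos (real k * d)"
      by (simp add: log_cos_def d_def)
  qed (use m in auto)
  have trap: "\<bar>integral {0..real m * d} log_cos - d * (?S + (log_cos 0 - log_cos (real m * d)) / 2)\<bar>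
      \<le> real m * (4 * pi\<^sup>2 * d ^ 3)"
    unfolding S
  proof (rule composite_trapezoid_error[where f' = "\<lambda>t. - pi * tan (pi * t)"])
    show "continuous_on {0..real m * d} log_cos"
      using md by (intro continuous_on_subset[OF log_cos_continuous]) auto
    show "\<bar>- pi * tan (pi * x) - - pi * tan (pi * y)\<bar> \<le> 4 * pi\<^sup>2 * \<bar>x - y\<bar>"
      if "0 < x" "x < real m * d" "0 < y" "y < real m * d" for x y
      using that md by (intro log_cos_derivative_lipschitz) auto
    show "(log_cos has_real_derivative - pi * tan (pi * x)) (at x)" if "0 < x" "x < real m * d" for x
      using that md by (intro log_cos_derivative) auto
  qed (use d in auto)
  have end_value: "\<bar>log_cos (real m * d)\<bar> \<le> 2 * pi * d"
  proof -
    have "log_cos (real m * d) \<le> 2 * pi * (1 / 3 - real m * d)" "0 \<le> log_cos (real m * d)"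
      using log_cos_near_third[of "real m * d"] md by auto
    moreover have "2 * pi * (1 / 3 - real m * d) \<le> 2 * pi * d"
      using md by (intro mult_left_mono) auto
    ultimately show ?thesis by linarith
  qed
  have rest: "\<bar>integral {real m * d..1/3} log_cos\<bar> \<le> 2 * pi * d * d"
  proof -
    have "norm (integral {real m * d..1/3} log_cos) \<le> 2 * pi * d * (1 / 3 - real m * d)"
    proof (rule integral_bound)
      fix t assume t: "t \<in> {real m * d..1/3}"
      have "2 * pi * (1 / 3 - t) \<le> 2 * pi * d" using md t by (intro mult_left_mono) auto
      moreover have "0 \<le> log_cos t" "log_cos t \<le> 2 * pi * (1 / 3 - t)"
        using log_cos_near_third[of t] t order_trans[OF md(3), of t] by auto
      ultimately show "norm (log_cos t) \<le> 2 * pi * d"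
        unfolding real_norm_def by linarith
    next
      show "continuous_on {real m * d..1/3} log_cos"
        using md by (intro continuous_on_subset[OF log_cos_continuous]) auto
    qed (use md in auto)
    also have "\<dots> \<le> 2 * pi * d * d" using md d by (intro mult_left_mono) auto
    finally show ?thesis by simp
  qed
  have split: "integral {0..1/3} log_cos = integral {0..real m * d} log_cos + integral {real m * d..1/3} log_cos"
    using md log_cos_continuous
    by (intro Henstock_Kurzweil_Integration.integral_combine[symmetric] integrable_continuous_interval) auto
  let ?T = "integral {0..real m * d} log_cos - d * (?S + (log_cos 0 - log_cos (real m * d)) / 2)"
  have "log_cos 0 = ln 2" by (simp add: log_cos_def)
  then have "?S - (p * integral {0..1/3} log_cos - ln 2 / 2)
      = - p * ?T - p * integral {real m * d..1/3} log_cos + log_cos (real m * d) / 2"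
    unfolding split using p by (simp add: d_def field_simps)
  also have "\<bar>\<dots>\<bar> \<le> p * \<bar>?T\<bar> + p * \<bar>integral {real m * d..1/3} log_cos\<bar> + \<bar>log_cos (real m * d)\<bar> / 2"
  proof -
    have tri: "\<bar>- p * x - p * y + z / 2\<bar> \<le> p * \<bar>x\<bar> + p * \<bar>y\<bar> + \<bar>z\<bar> / 2" for x y z
    proof -
      have "\<bar>- p * x\<bar> = p * \<bar>x\<bar>" "\<bar>p * y\<bar> = p * \<bar>y\<bar>" using p by (simp_all add: abs_mult)
      then show ?thesis by linarith
    qed
    show ?thesis by (rule tri)
  qed
  also have "\<dots> \<le> p * (real m * (4 * pi\<^sup>2 * d ^ 3)) + p * (2 * pi * d * d) + (2 * pi * d) / 2"
    using trap rest end_value p by (intro add_mono mult_left_mono divide_right_mono) auto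
  also have "\<dots> = (real m / p) * (4 * pi\<^sup>2 / p) + 3 * pi / p"
    using p by (simp add: d_def field_simps power3_eq_cube)
  also have "\<dots> \<le> 1 * (4 * pi\<^sup>2 / p) + 3 * pi / p"
    using m p by (intro add_mono mult_right_mono) auto
  also have "\<dots> = (4 * pi\<^sup>2 + 3 * pi) / p" by (simp add: add_divide_distrib)
  also have "\<dots> \<le> (4 * pi\<^sup>2 + 3 * pi) / real n"
    using p n by (intro divide_left_mono) (auto intro!: add_nonneg_nonneg)
  finally show ?thesis unfolding p_def .
qed


section \<open>Integration over the circle\<close>

lemma cis_turn_measurable:
  "(\<lambda>t. cis (2 * pi * t)) \<in> restrict_space lborel {0..1} \<rightarrow>\<^sub>M restrict_space borel (sphere 0 1)"
proof -
  have "(\<lambda>t::real. cis (2 * pi * t)) \<in> borel_measurable borel"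
    by (intro borel_measurable_continuous_onI continuous_intros)
  then show ?thesis
    by (auto intro!: measurable_restrict_space2 measurable_restrict_space1)
qed

lemma space_circle_haar [simp]: "space circle_haar = sphere 0 1"
  by (simp add: circle_haar_def space_restrict_space)

lemma measurable_circle_haar [measurable (raw)]:
  assumes "f \<in> borel_measurable borel"
  shows "f \<in> borel_measurable circle_haar"
  using measurable_restrict_space1[OF assms]
  by (simp add: circle_haar_def)

lemma id_measurable_circle_haar [measurable]: "(\<lambda>x. x) \<in> circle_haar \<rightarrow>\<^sub>M borel"
  by (rule measurable_circle_haar) simp

interpretation circle_haar: finite_measure circle_haar
  by (rule finite_measureI) (simp only: emeasure_circle_haar_space, simp)

interpretation torus: pair_sigma_finite circle_haar circle_haar
  by unfold_locales

lemma circle_haar_continuous: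
  fixes f :: "complex \<Rightarrow> real"
  assumes f: "f \<in> borel_measurable borel"
    and cont: "continuous_on {0..1} (\<lambda>t. f (cis (2 * pi * t)))"
  shows "integrable circle_haar f"
    and "integral\<^sup>L circle_haar f = integral {0..1} (\<lambda>t. f (cis (2 * pi * t)))"
proof -
  have f': "f \<in> borel_measurable (restrict_space borel (sphere 0 1))"
    using f by (rule measurable_restrict_space1)
  have int: "set_integrable lborel {0..1} (\<lambda>t. f (cis (2 * pi * t)))"
    using cont by (rule borel_integrable_atLeastAtMost')
  then show "integrable circle_haar f"
    unfolding circle_haar_def
    by (subst integrable_distr_eq[OF cis_turn_measurable f'], subst integrable_restrict_space)
       (simp_all add: set_integrable_def)
  show "integral\<^sup>L circle_haar f = integral {0..1} (\<lambda>t. f (cis (2 * pi * t)))"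
    unfolding circle_haar_def
    by (subst integral_distr[OF cis_turn_measurable f'], subst integral_restrict_space)
       (use set_borel_integral_eq_integral(2)[OF int] in \<open>simp_all add: set_lebesgue_integral_def\<close>)
qed

lemma AE_circle_haar_iff:
  assumes "Measurable.pred borel P"
  shows "(AE x in circle_haar. P x) \<longleftrightarrow> (AE t in lborel. t \<in> {0..1} \<longrightarrow> P (cis (2 * pi * t)))"
proof -
  have "{x \<in> space (restrict_space borel (sphere 0 1)). P x} \<in> sets (restrict_space borel (sphere 0 1))"
    using measurable_restrict_space1[OF assms, of "sphere 0 1"] by (simp only: pred_def)
  then show ?thesis
    unfolding circle_haar_def
    by (subst AE_distr_iff[OF cis_turn_measurable], assumption, subst AE_restrict_space_iff) auto
qed


section \<open>Jensen's formula on the circle\<close>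

text \<open>
  The mean value property at the centre for \<open>log (1 + b z)\<close>, which is holomorphic near the closed
  unit disc because \<open>1 + b z\<close> has positive real part there. Cauchy's integral formula at \<open>0\<close> gives the
  mean as \<open>log 1 = 0\<close>; its real part is the claim.
\<close>
lemma mean_log_inside:
  fixes b :: complex
  assumes b: "cmod b < 1"
  shows "((\<lambda>t. ln (cmod (1 + b * cis (2 * pi * t)))) has_integral 0) {0..1}"
proof -
  have pos: "Re (1 + b * z) > 0" if "cmod z \<le> 1" for z
  proof -
    have "cmod (b * z) < 1" using b that by (metis norm_mult mult_left_le norm_ge_zero le_less_trans)
    then show ?thesis using abs_Re_le_cmod[of "b * z"] by simp
  qed
  have "(\<lambda>z. Ln (1 + b * z)) holomorphic_on cball 0 1"
    using pos by (intro holomorphic_intros) (auto simp: complex_nonpos_Reals_iff not_le[symmetric])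
  from Cauchy_integral_circlepath_simple[OF this, of 0]
  have "((\<lambda>u. Ln (1 + b * u) / u) has_contour_integral 0) (circlepath 0 1)" by simp
  then have "((\<lambda>t. Ln (1 + b * cis (2 * pi * t)) / cis (2 * pi * t) * (2 * pi * \<i> * cis (2 * pi * t)))
      has_integral 0) {0..1}"
    unfolding has_contour_integral_def
  proof (rule has_integral_eq[rotated])
    fix t :: real assume "t \<in> {0..1}"
    then show "Ln (1 + b * circlepath 0 1 t) / circlepath 0 1 t * vector_derivative (circlepath 0 1) (at t within {0..1})
        = Ln (1 + b * cis (2 * pi * t)) / cis (2 * pi * t) * (2 * pi * \<i> * cis (2 * pi * t))"
      by (subst vector_derivative_circlepath01) (simp_all add: circlepath cis_conv_exp mult_ac)
  qed
  then have int: "((\<lambda>t. Ln (1 + b * cis (2 * pi * t)) * (2 * of_real pi * \<i>)) has_integral 0) {0..1}"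
    by (simp add: mult.assoc)
  have "z * (2 * of_real pi * \<i>) * inverse (2 * of_real pi * \<i>) = z" for z
  proof -
    have "2 * complex_of_real pi * \<i> \<noteq> 0" by simp
    from right_inverse[OF this] show ?thesis by (simp only: mult.assoc[of z] mult_1_right)
  qed
  with has_integral_mult_left[OF int, of "inverse (2 * of_real pi * \<i>)"]
  have "((\<lambda>t. Ln (1 + b * cis (2 * pi * t))) has_integral 0) {0..1}"
    by (simp only: mult_zero_left)
  from has_integral_Re[OF this]
  have "((\<lambda>t. Re (Ln (1 + b * cis (2 * pi * t)))) has_integral 0) {0..1}" by simp
  then show ?thesis
  proof (rule has_integral_eq[rotated])
    fix t :: real
    have "1 + b * cis (2 * pi * t) \<noteq> 0" using pos[of "cis (2 * pi * t)"] by force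
    then show "Re (Ln (1 + b * cis (2 * pi * t))) = ln (cmod (1 + b * cis (2 * pi * t)))" by simp
  qed
qed

text \<open>
  For \<open>|a| > 1\<close> factor out \<open>a\<close>. For \<open>|a| < 1\<close> factor out the unimodular number \<open>x\<close> instead: on the circle,
  \<open>|x + a| = |1 + cnj a * x|\<close>. In both cases the mean value property leaves only the constant. Staying off
  \<open>|a| = 1\<close> keeps the integrand continuous.
\<close>
lemma jensen_circle:
  fixes a :: complex
  assumes a: "cmod a \<noteq> 1"
  shows "integrable circle_haar (\<lambda>x. ln (cmod (x + a)))"
    and "(\<integral>x. ln (cmod (x + a)) \<partial>circle_haar) = max 0 (ln (cmod a))"
proof -
  have nz: "cis (2 * pi * t) + a \<noteq> 0" for t
    using a by (metis add_eq_0_iff norm_cis norm_minus_cancel)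
  have cont: "continuous_on {0..1} (\<lambda>t. ln (cmod (cis (2 * pi * t) + a)))"
    using nz by (intro continuous_intros) auto
  have meas: "(\<lambda>x. ln (cmod (x + a))) \<in> borel_measurable borel" by measurable
  show "integrable circle_haar (\<lambda>x. ln (cmod (x + a)))"
    by (rule circle_haar_continuous(1)[OF meas cont])
  have "((\<lambda>t. ln (cmod (cis (2 * pi * t) + a))) has_integral max 0 (ln (cmod a))) {0..1}"
  proof (cases "cmod a < 1")
    case True
    have "cmod (cis (2 * pi * t) + a) = cmod (1 + cnj a * cis (2 * pi * t))" for t
    proof -
      have "cis (2 * pi * t) + a = cis (2 * pi * t) * cnj (1 + cnj a * cis (2 * pi * t))"
        by (simp add: cis_cnj algebra_simps cis_mult)
      then show ?thesis by (metis complex_mod_cnj mult_1 norm_cis norm_mult)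
    qed
    moreover have "max 0 (ln (cmod a)) = 0" using True by (cases "a = 0") auto
    ultimately show ?thesis using mean_log_inside[of "cnj a"] True by simp
  next
    case False
    then have a1: "cmod a > 1" using a by simp
    then have "0 < cmod a" by linarith
    then have b: "cmod (1 / a) < 1" using a1 by (simp add: norm_divide)
    have "ln (cmod (cis (2 * pi * t) + a)) = ln (cmod a) + ln (cmod (1 + 1 / a * cis (2 * pi * t)))" for t
    proof -
      have a0: "a \<noteq> 0" using a1 by auto
      then have e: "cis (2 * pi * t) + a = a * (1 + 1 / a * cis (2 * pi * t))" by (simp add: algebra_simps)
      then have "1 + 1 / a * cis (2 * pi * t) \<noteq> 0" using nz[of t] by (metis mult_zero_right)
      then show ?thesis unfolding e norm_mult using a0 by (subst ln_mult) auto
    qed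
    moreover have "((\<lambda>t. ln (cmod a) + ln (cmod (1 + 1 / a * cis (2 * pi * t)))) has_integral
        ln (cmod a) + 0) {0..1}"
      using has_integral_const_real[of "ln (cmod a)" 0 1]
      by (intro has_integral_add mean_log_inside b) auto
    ultimately show ?thesis using a1 by simp
  qed
  then show "(\<integral>x. ln (cmod (x + a)) \<partial>circle_haar) = max 0 (ln (cmod a))"
    by (simp add: circle_haar_continuous(2)[OF meas cont] integral_unique)
qed

text \<open>
  The slices to which Jensen's formula does not apply form a null set. If \<open>2 cos \<theta> = \<plusminus> 1\<close>, then
  \<open>cos 2\<theta> = - 1/2\<close>, hence \<open>cos 6\<theta> = 1\<close>, and \<open>\<theta>\<close> is a multiple of \<open>\<pi>/3\<close>.
\<close>
lemma AE_slice_off_circle: "AE y in circle_haar. cmod (y + 1 / y) \<noteq> 1"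
proof -
  have "t \<in> range (\<lambda>n::int. of_int n / 6)" if "cmod (cis (2 * pi * t) + 1 / cis (2 * pi * t)) = 1" for t
  proof -
    define c where "c = cos (2 * (2 * pi * t))"
    have "\<bar>2 * cos (2 * pi * t)\<bar> = 1" using that unfolding cis_add_inverse[unfolded inverse_eq_divide] norm_of_real .
    then have "(2 * cos (2 * pi * t))\<^sup>2 = 1" by (metis power2_abs one_power2)
    moreover have "c = 2 * (cos (2 * pi * t))\<^sup>2 - 1" unfolding c_def by (rule cos_double_cos)
    ultimately have "c = - 1 / 2" by (simp add: power_mult_distrib)
    moreover have "cos (3 * (2 * (2 * pi * t))) = 4 * c ^ 3 - 3 * c"
      unfolding c_def by (rule cos_treble_cos)
    ultimately have "cos (3 * (2 * (2 * pi * t))) = 1" by (simp add: power3_eq_cube)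
    then obtain n :: int where "3 * (2 * (2 * pi * t)) = n * 2 * pi" by (auto simp: cos_one_2pi_int)
    then have "t = of_int n / 6" by (simp add: field_simps)
    then show ?thesis by blast
  qed
  moreover have "range (\<lambda>n::int. real_of_int n / 6) \<in> null_sets lborel"
    by (intro countable_imp_null_set_lborel) auto
  then have "AE t in lborel. t \<notin> range (\<lambda>n::int. real_of_int n / 6)" by (rule AE_not_in)
  ultimately have "AE t in lborel. cmod (cis (2 * pi * t) + 1 / cis (2 * pi * t)) \<noteq> 1"
    by (auto elim!: eventually_mono)
  then show ?thesis
    by (subst AE_circle_haar_iff) auto
qed

text \<open>
  Since \<open>log |x + a| \<le> log 3\<close>, the absolute value of the logarithm is at most \<open>2 log 3\<close> minus the logarithm
  itself, and the mean of the latter is nonnegative by Jensen's formula. The bound is uniform in the slice, as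
  integrability on the torus requires despite the logarithmic singularities.
\<close>
lemma slice_abs_bound:
  assumes a: "cmod a \<noteq> 1" "cmod a \<le> 2"
  shows "(\<integral>x. \<bar>ln (cmod (x + a))\<bar> \<partial>circle_haar) \<le> 2 * ln 3"
proof -
  have "\<bar>ln (cmod (x + a))\<bar> \<le> 2 * ln 3 - ln (cmod (x + a))" if "x \<in> space circle_haar" for x
  proof -
    have "cmod (x + a) \<le> 3" using norm_triangle_ineq[of x a] that a by simp
    then have "ln (cmod (x + a)) \<le> ln 3" by (cases "x + a = 0") auto
    then show ?thesis using ln_ge_zero[of 3] by linarith
  qed
  then have "(\<integral>x. \<bar>ln (cmod (x + a))\<bar> \<partial>circle_haar) \<le> (\<integral>x. 2 * ln 3 - ln (cmod (x + a)) \<partial>circle_haar)"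
    using jensen_circle(1)[OF a(1)] by (intro integral_mono) auto
  also have "\<dots> = 2 * ln 3 - max 0 (ln (cmod a))"
    using jensen_circle[OF a(1)] emeasure_circle_haar_space
    by (subst Bochner_Integration.integral_diff) (auto simp: measure_def)
  finally show ?thesis by simp
qed


section \<open>The Mahler measure of the curve\<close>

text \<open>
  Fubini, with the variable \<open>x\<^sub>0\<close> integrated first. Without integrability on the torus the
  iterated integral would say nothing about \<open>mC2\<close>, so that comes before the evaluation.
\<close>
lemma mC2_eq_integral: "mC2 = integral {0..1} (\<lambda>t. max 0 (ln \<bar>2 * cos (2 * pi * t)\<bar>))"
proof -
  let ?k = "\<lambda>(y, x). ln (cmod (x + (y + 1 / y)))"
  have k_meas [measurable]: "?k \<in> borel_measurable (circle_haar \<Otimes>\<^sub>M circle_haar)"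
    by measurable
  have size: "AE y in circle_haar. cmod (y + 1 / y) \<noteq> 1 \<and> cmod (y + 1 / y) \<le> 2"
  proof -
    have "AE y in circle_haar. cmod (y + 1 / y) \<le> 2"
    proof (rule AE_I2)
      fix y assume "y \<in> space circle_haar"
      then have "cmod y = 1" by simp
      then show "cmod (y + 1 / y) \<le> 2"
        using norm_triangle_ineq[of y "1 / y"] by (simp add: norm_divide)
    qed
    then show ?thesis using AE_slice_off_circle by eventually_elim simp
  qed
  have k_int: "integrable (circle_haar \<Otimes>\<^sub>M circle_haar) ?k"
  proof (rule torus.Fubini_integrable[OF k_meas])
    show "AE y in circle_haar. integrable circle_haar (\<lambda>x. ?k (y, x))"
      using size by eventually_elim (simp add: jensen_circle(1))
    have "AE y in circle_haar. norm (\<integral>x. norm (?k (y, x)) \<partial>circle_haar) \<le> norm (2 * ln 3 :: real)"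
      using size
    proof eventually_elim
      case (elim y)
      then have "(\<integral>x. \<bar>ln (cmod (x + (y + 1 / y)))\<bar> \<partial>circle_haar) \<le> 2 * ln 3"
        by (intro slice_abs_bound) auto
      then show ?case by simp
    qed
    moreover have "(\<lambda>y. \<integral>x. norm (?k (y, x)) \<partial>circle_haar) \<in> borel_measurable circle_haar"
      by measurable
    moreover have "integrable circle_haar (\<lambda>_. 2 * ln 3 :: real)" by simp
    ultimately show "integrable circle_haar (\<lambda>y. \<integral>x. norm (?k (y, x)) \<partial>circle_haar)"
      using Bochner_Integration.integrable_bound by blast
  qed
  have "mC2 = (\<integral>(x, y). ?k (y, x) \<partial>(circle_haar \<Otimes>\<^sub>M circle_haar))"
    unfolding mC2_def by (intro Bochner_Integration.integral_cong) (auto simp: add.assoc)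
  also have "\<dots> = integral\<^sup>L (circle_haar \<Otimes>\<^sub>M circle_haar) ?k"
    by (rule torus.integral_product_swap[OF k_meas])
  also have "\<dots> = (\<integral>y. \<integral>x. ?k (y, x) \<partial>circle_haar \<partial>circle_haar)"
    by (rule torus.integral_fst'[OF k_int, symmetric])
  also have "\<dots> = (\<integral>y. max 0 (ln (cmod (y + 1 / y))) \<partial>circle_haar)"
  proof (rule integral_cong_AE)
    show "AE y in circle_haar. (\<integral>x. ?k (y, x) \<partial>circle_haar) = max 0 (ln (cmod (y + 1 / y)))"
      using size by eventually_elim (simp add: jensen_circle(2))
  qed measurable
  also have "\<dots> = integral {0..1} (\<lambda>t. max 0 (ln (cmod (cis (2 * pi * t) + 1 / cis (2 * pi * t)))))"
  proof (rule circle_haar_continuous(2))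
    \<comment> \<open>In the form \<open>ln (max 1 u)\<close> the integrand is visibly continuous where \<open>u = 0\<close>.\<close>
    have "max 0 (ln u) = ln (max 1 u)" if "u \<ge> 0" for u :: real
      using that by (cases "u = 0") (auto simp: max_def)
    then show "continuous_on {0..1} (\<lambda>t. max 0 (ln (cmod (cis (2 * pi * t) + 1 / cis (2 * pi * t)))))"
      by (auto intro!: continuous_intros)
  qed measurable
  finally show ?thesis unfolding cis_add_inverse[unfolded inverse_eq_divide] norm_of_real .
qed

text \<open>
  In \<open>u = 2t\<close> the integrand has period \<open>1\<close> and is symmetric about \<open>1/2\<close>. On \<open>[0, 1]\<close> it is \<open>log_cos\<close>
  up to \<open>1/3\<close>, zero on the middle third, and the mirror image of \<open>log_cos\<close> on the last third.
\<close>
lemma mC2_eq: "mC2 = 2 * integral {0..1/3} log_cos"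
proof -
  define H where "H = integral {0..1/3} log_cos"
  define G where "G u = max 0 (ln \<bar>2 * cos (pi * u)\<bar>)" for u
  have "(log_cos has_integral H) {0..1/3}"
    unfolding H_def by (intro integrable_integral integrable_continuous_interval log_cos_continuous)
  then have first: "(G has_integral H) {0..1/3}"
  proof (rule has_integral_eq[rotated])
    fix u :: real assume "u \<in> {0..1/3}"
    then show "log_cos u = G u"
      using log_cos_near_third(1)[of u] cos_ge_half[of u] by (simp add: G_def log_cos_def)
  qed
  have mid: "(G has_integral 0) {1/3..2/3}"
  proof (rule has_integral_is_0)
    fix u :: real assume u: "u \<in> {1/3..2/3}"
    have "cos (pi * u) \<le> cos (pi / 3)" "cos (2 * pi / 3) \<le> cos (pi * u)"
      using u by (auto intro!: cos_monotone_0_pi_le simp: field_simps)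
    then have "\<bar>2 * cos (pi * u)\<bar> \<le> 1" by (simp add: cos_60 cos_120)
    then have "ln \<bar>2 * cos (pi * u)\<bar> \<le> 0" by (cases "cos (pi * u) = 0") auto
    then show "G u = 0" by (simp add: G_def)
  qed
  have refl: "G (- (u - 1)) = G u" and per: "G (u - 1) = G u" for u
    by (simp_all add: G_def right_diff_distrib cos_diff)
  have "((\<lambda>u. G (- u)) has_integral H) {- (1/3)..0}"
    using has_integral_reflect_lemma_real[OF first] by simp
  from has_integral_shift_real_ivl[OF this, of "- 1"]
  have last: "(G has_integral H) {2/3..1}" using refl by simp
  have one: "(G has_integral H + 0 + H) {0..1}"
    by (rule has_integral_combine[OF _ _ has_integral_combine[OF _ _ first mid] last]) auto
  from has_integral_shift_real_ivl[OF one, of "- 1"]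
  have "(G has_integral H + 0 + H) {1..2}" using per by simp
  from has_integral_combine[OF _ _ one this]
  have "(G has_integral 4 * H) (cbox 0 2)" by simp
  from has_integral_affinity'[OF this, of 2 0]
  have "((\<lambda>t. G (2 * t)) has_integral 2 * H) {0..1}" by simp
  then show ?thesis
    unfolding mC2_eq_integral H_def[symmetric] by (simp add: G_def integral_unique mult_ac)
qed


section \<open>The asymptotic formula\<close>

theorem proposition3p4p1:
  shows "(\<lambda>n. mahler (alpha n) - (mC2 * real n + 1 / 2 * (mC2 - ln 2)))
           \<in> O[inf at_top (principal N2)](\<lambda>n. 1 / real n)"
proof (rule bigoI)
  have "norm (mahler (alpha n) - (mC2 * real n + 1 / 2 * (mC2 - ln 2)))
      \<le> (4 * pi\<^sup>2 + 3 * pi) * norm (1 / real n)" if "n \<in> N2" for n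
  proof -
    have n: "n > 0" "prime (2 * n + 1)" using that by (auto simp: N2_def)
    have "mC2 * real n + 1 / 2 * (mC2 - ln 2) = real (2 * n + 1) * integral {0..1/3} log_cos - ln 2 / 2"
      unfolding mC2_eq by (simp add: algebra_simps)
    then show ?thesis
      using sum_log_cos_asymp[OF n(1)] mahler_alpha[OF n(2,1)] by simp
  qed
  then show "eventually (\<lambda>n. norm (mahler (alpha n) - (mC2 * real n + 1 / 2 * (mC2 - ln 2)))
      \<le> (4 * pi\<^sup>2 + 3 * pi) * norm (1 / real n)) (inf at_top (principal N2))"
    by (simp add: eventually_inf_principal)
qed

end
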